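(* Let $(\mathbb{V},\rho)$ be a (finite-dimensional) real linear representation of $\mathrm{O}(2)$ which decomposes as $$\mathbb{V}\simeq m_{-1}\mathbb{H}^{-1}(\mathbb{R}^2)\oplus m_0\mathbb{H}^0(\mathbb{R}^2)\oplus\mathbb{H}^{n_1}(\mathbb{R}^2)\oplus\dots\oplus\mathbb{H}^{n_r}(\mathbb{R}^2),$$ where $m_{-1},m_0\in\mathbb{N}$ and $n_k\in\mathbb{N}^*=\{1,2,\dots\}$. Let $\xi_i$, $\lambda_k$, $z_s$ be the coordinates on the factors $\mathbb{H}^{-1}$, $\mathbb{H}^0$, $\mathbb{H}^{n_s}$ respectively. Then an integrity basis for $\mathrm{Inv}(\mathbb{V},\mathrm{O}(2))$ consists of the homogeneous invariants $$\lambda_k,\quad |z_s|^2,\quad \mathrm{Re}(\mathbf{m}_l),\quad \xi_i\xi_j,\quad \xi_i\,\mathrm{Im}(\mathbf{m}_l),\quad \mathrm{Im}(\mathbf{m}_p)\mathrm{Im}(\mathbf{m}_q),$$ where the $\mathbf{m}_l$ are the irreducible solutions of the Diophantine equation $$n_1\alpha_1+\dots+n_r\alpha_r-n_1\beta_1-\dots-n_r\beta_r=0,\qquad\alpha_i,\beta_i\in\mathbb{N},$$ (viewed as monomials) such that $\mathbf{m}_l\neq\overline{\mathbf{m}}_l$, and where only those products $\mathrm{Im}(\mathbf{m}_p)\mathrm{Im}(\mathbf{m}_q)$ are kept for which neither $\mathbf{m}_p\mathbf{m}_q$ nor $\mathbf{m}_p\overline{\mathbf{m}}_q$ contains a factor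 $z_s\overline{z}_s$ for some $s\in\{1,\dots,r\}$.
   Context: $\mathrm{O}(2)$ is generated by the rotations $r_\theta$ and the reflection $\sigma=\mathrm{diag}(1,-1)$. $\mathbb{H}^0(\mathbb{R}^2)=\mathbb{R}$ is the trivial representation, $\mathbb{H}^{-1}(\mathbb{R}^2)=\mathbb{R}$ the sign representation ($g$ acts by $\det g$); for $n\ge1$, $\mathbb{H}^n(\mathbb{R}^2)$ is the real two-dimensional irreducible representation on which $r_\theta$ acts as the rotation of angle $n\theta$ and $\sigma$ as $\mathrm{diag}(1,-1)$. A point with components $(a,b)$ in $\mathbb{H}^{n}$ is encoded by $a+ib\in\mathbb{C}$, so on the coordinate $z_s$ of $\mathbb{H}^{n_s}$, $r_\theta$ acts by $z_s\mapsto e^{in_s\theta}z_s$ and $\sigma$ by $z_s\mapsto\overline{z}_s$. $\mathrm{Inv}(\mathbb{V},G)$ is the algebra of real polynomial functions $p$ on $\mathbb{V}$ with $g\star p=p$ for all $g\in G$, $(g\star p)(v)=p(\rho(g)^{-1}v)$. An integrity basis is a finite set of homogeneous invariants generating this algebra. To $(\alpha,\beta)\in\mathbb{N}^{2r}$ is associated the monomial $\mathbf{m}=z_1^{\alpha_1}\cdots z_r^{\alpha_r}\overline{z}_1^{\beta_1}\cdots\overline{z}_r^{\beta_r}$. A (non-zero) solution of the Diophantine equation is irreducible if it is not the sum of two non-trivial (non-zero) solutions in $\mathbb{N}^{2r}$. *)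

theory Defs
  imports "HOL-Analysis.Analysis"
begin

definition rot :: "real \<Rightarrow> real^2^2" where
  "rot \<theta> = vector [vector [cos \<theta>, - sin \<theta>], vector [sin \<theta>, cos \<theta>]]"

definition reflection :: "real^2^2" where
  "reflection = vector [vector [1, 0], vector [0, - 1]]"

definition O2 :: "(real^2^2) set" where
  "O2 = {g. orthogonal_matrix g}"

text \<open>The values of \<open>\<rho>\<close> outside \<open>O2\<close> are irrelevant. The norm on the type \<open>'v\<close> only serves
  to make the library notion \<^term>\<open>real_polynomial_function\<close> available; in finite dimension
  every linear functional is bounded, so that notion is independent of the norm. Unlike
  \<^class>\<open>euclidean_space\<close>, the class does not exclude the zero space.\<close>

definition O2_representation :: "(real^2^2 \<Rightarrow> 'v::real_normed_vector \<Rightarrow> 'v) \<Rightarrow> bool" where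
  "O2_representation \<rho> \<longleftrightarrow>
     (\<forall>g\<in>O2. linear (\<rho> g)) \<and>
     \<rho> (mat 1) = id \<and>
     (\<forall>g\<in>O2. \<forall>h\<in>O2. \<rho> (g ** h) = \<rho> g \<circ> \<rho> h)"

text \<open>An isomorphism of representations from \<open>'v\<close> onto
  \<open>m\<^sub>-\<^sub>1 H\<^sup>-\<^sup>1 \<oplus> m\<^sub>0 H\<^sup>0 \<oplus> H\<^bsup>n 0\<^esup> \<oplus> \<dots> \<oplus> H\<^bsup>n (r - 1)\<^esup>\<close>, given by its components: \<open>xi i\<close> (\<open>i < mm\<close>, where \<open>mm\<close> is
  the multiplicity \<open>m\<^sub>-\<^sub>1\<close>), \<open>lam k\<close> (\<open>k < m0\<close>) and \<open>z s\<close> (\<open>s < r\<close>), the factor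
  \<open>H\<^bsup>n s\<^esup>\<close> being identified with the complex numbers. Together they form a real-linear bijection,
  so \<open>'v\<close> has dimension \<open>mm + m0 + 2 * r\<close>. Equivariance on the factors \<open>H\<^bsup>n s\<^esup>\<close> is required
  on the generators \<open>rot \<theta>\<close> and \<open>reflection\<close> of \<open>O2\<close>, which is how these factors are defined.\<close>

definition O2_decomposition ::
  "(real^2^2 \<Rightarrow> 'v::real_normed_vector \<Rightarrow> 'v) \<Rightarrow> nat \<Rightarrow> nat \<Rightarrow> nat \<Rightarrow> (nat \<Rightarrow> nat) \<Rightarrow>
   (nat \<Rightarrow> 'v \<Rightarrow> real) \<Rightarrow> (nat \<Rightarrow> 'v \<Rightarrow> real) \<Rightarrow> (nat \<Rightarrow> 'v \<Rightarrow> complex) \<Rightarrow> bool" where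
  "O2_decomposition \<rho> mm m0 r n xi lam z \<longleftrightarrow>
     (\<forall>i<mm. linear (xi i)) \<and> (\<forall>k<m0. linear (lam k)) \<and> (\<forall>s<r. linear (z s)) \<and>
     bij_betw
       (\<lambda>v. (restrict (\<lambda>i. xi i v) {..<mm},
             restrict (\<lambda>k. lam k v) {..<m0},
             restrict (\<lambda>s. z s v) {..<r}))
       UNIV
       (({..<mm} \<rightarrow>\<^sub>E UNIV) \<times> ({..<m0} \<rightarrow>\<^sub>E UNIV) \<times> ({..<r} \<rightarrow>\<^sub>E UNIV)) \<and>
     (\<forall>i<mm. \<forall>g\<in>O2. \<forall>v. xi i (\<rho> g v) = det g * xi i v) \<and>
     (\<forall>k<m0. \<forall>g\<in>O2. \<forall>v. lam k (\<rho> g v) = lam k v) \<and>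
     (\<forall>s<r. \<forall>\<theta> v. z s (\<rho> (rot \<theta>) v) = cis (real (n s) * \<theta>) * z s v) \<and>
     (\<forall>s<r. \<forall>v. z s (\<rho> reflection v) = cnj (z s v))"

definition star_action :: "(real^2^2 \<Rightarrow> 'v \<Rightarrow> 'v) \<Rightarrow> real^2^2 \<Rightarrow> ('v \<Rightarrow> real) \<Rightarrow> 'v \<Rightarrow> real" where
  "star_action \<rho> g p = (\<lambda>v. p (inv (\<rho> g) v))"

definition Inv_O2 :: "(real^2^2 \<Rightarrow> 'v::real_normed_vector \<Rightarrow> 'v) \<Rightarrow> ('v \<Rightarrow> real) set" where
  "Inv_O2 \<rho> = {p. real_polynomial_function p \<and> (\<forall>g\<in>O2. star_action \<rho> g p = p)}"

definition homogeneous_function :: "('v::real_vector \<Rightarrow> real) \<Rightarrow> bool" where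
  "homogeneous_function p \<longleftrightarrow> (\<exists>d::nat. \<forall>t v. p (t *\<^sub>R v) = t ^ d * p v)"

inductive_set generated_algebra :: "('v \<Rightarrow> real) set \<Rightarrow> ('v \<Rightarrow> real) set"
  for B :: "('v \<Rightarrow> real) set" where
  gen: "p \<in> B \<Longrightarrow> p \<in> generated_algebra B"
| const: "(\<lambda>v. c) \<in> generated_algebra B"
| add: "p \<in> generated_algebra B \<Longrightarrow> q \<in> generated_algebra B \<Longrightarrow>
        (\<lambda>v. p v + q v) \<in> generated_algebra B"
| mult: "p \<in> generated_algebra B \<Longrightarrow> q \<in> generated_algebra B \<Longrightarrow>
         (\<lambda>v. p v * q v) \<in> generated_algebra B"

definition integrity_basis ::
  "(real^2^2 \<Rightarrow> 'v::real_normed_vector \<Rightarrow> 'v) \<Rightarrow> ('v \<Rightarrow> real) set \<Rightarrow> bool" where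
  "integrity_basis \<rho> B \<longleftrightarrow>
     finite B \<and> (\<forall>p\<in>B. p \<in> Inv_O2 \<rho> \<and> homogeneous_function p) \<and>
     generated_algebra B = Inv_O2 \<rho>"

text \<open>A pair \<open>(\<alpha>, \<beta>)\<close> of exponent functions vanishing from \<open>r\<close> on encodes an element of \<open>\<nat>\<^bsup>2r\<^esup>\<close>,
  hence a monomial in \<open>z\<^sub>s\<close> and their conjugates. Addition of exponents is multiplication of
  monomials.\<close>

type_synonym exponents = "(nat \<Rightarrow> nat) \<times> (nat \<Rightarrow> nat)"

definition exps_zero :: exponents where
  "exps_zero = (\<lambda>s. 0, \<lambda>s. 0)"

definition exps_add :: "exponents \<Rightarrow> exponents \<Rightarrow> exponents" where
  "exps_add m m' = (\<lambda>s. fst m s + fst m' s, \<lambda>s. snd m s + snd m' s)"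

definition exps_conj :: "exponents \<Rightarrow> exponents" where
  "exps_conj m = (snd m, fst m)"

definition monomial_fun ::
  "nat \<Rightarrow> (nat \<Rightarrow> 'v \<Rightarrow> complex) \<Rightarrow> exponents \<Rightarrow> 'v \<Rightarrow> complex" where
  "monomial_fun r z m v = (\<Prod>s<r. z s v ^ fst m s) * (\<Prod>s<r. cnj (z s v) ^ snd m s)"

definition has_factor_z_cnj :: "nat \<Rightarrow> exponents \<Rightarrow> bool" where
  "has_factor_z_cnj r m \<longleftrightarrow> (\<exists>s<r. fst m s \<ge> 1 \<and> snd m s \<ge> 1)"

definition solutions :: "nat \<Rightarrow> (nat \<Rightarrow> nat) \<Rightarrow> exponents set" where
  "solutions r n = {(\<alpha>, \<beta>). (\<forall>s\<ge>r. \<alpha> s = 0 \<and> \<beta> s = 0) \<and>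
     (\<Sum>s<r. int (n s) * int (\<alpha> s)) - (\<Sum>s<r. int (n s) * int (\<beta> s)) = 0}"

definition irreducible_solutions :: "nat \<Rightarrow> (nat \<Rightarrow> nat) \<Rightarrow> exponents set" where
  "irreducible_solutions r n = {m \<in> solutions r n. m \<noteq> exps_zero \<and>
     \<not> (\<exists>a \<in> solutions r n. \<exists>b \<in> solutions r n.
          a \<noteq> exps_zero \<and> b \<noteq> exps_zero \<and> m = exps_add a b)}"

end

theory Submission
  imports Defs
begin

text \<open>Why the listed invariants generate. A polynomial on the representation is a combination of
  products of a monomial in the \<open>\<lambda>\<^sub>k\<close>, a monomial in the \<open>\<xi>\<^sub>i\<close> and the real part of a complex multiple
  of a monomial \<open>m\<close> in the \<open>z\<^sub>s\<close> and their conjugates. Averaging over the rotations kills the products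
  in which \<open>m\<close> has nonzero weight, that is, in which \<open>m\<close> does not solve the Diophantine equation.
  Averaging over the reflection, which conjugates \<open>m\<close> and negates each \<open>\<xi>\<^sub>i\<close>, leaves \<open>Re m\<close> times an
  even number of factors \<open>\<xi>\<^sub>i\<close> and \<open>Im m\<close> times an odd number of them. So the invariants are
  generated by the \<open>\<lambda>\<^sub>k\<close>, the \<open>\<xi>\<^sub>i \<xi>\<^sub>j\<close>, and the \<open>Re m\<close> and \<open>\<xi>\<^sub>i Im m\<close> for all solutions \<open>m\<close>. A given
  polynomial involves only finitely many weights, so the average can be taken over the finite group
  of symmetries of a regular \<open>N\<close>-gon with \<open>N\<close> large (\<open>eventually_average_in_algebra\<close>).

  It remains to pass from all solutions to irreducible ones, by induction on the degree
  (\<open>Re_and_Im_Im_in_algebra\<close>, \<open>xi_Im_in_algebra\<close>). For a product of solutions,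
  \<open>Re (ab) = Re a Re b - Im a Im b\<close> and \<open>Im (ab) = Re a Im b + Im a Re b\<close>, so the point is to generate
  \<open>Im a Im b\<close> for irreducible \<open>a\<close>, \<open>b\<close>. It equals both \<open>Re a Re b - Re (ab)\<close> and
  \<open>Re (a cnj b) - Re a Re b\<close>. If \<open>ab\<close> or \<open>a cnj b\<close> has a factor \<open>z\<^sub>s cnj z\<^sub>s\<close>, the cofactor of \<open>|z\<^sub>s|\<^sup>2\<close> is a
  solution of smaller degree and the induction hypothesis applies; the remaining products
  \<open>Im a Im b\<close> are in the list.

  That the list is finite amounts to a bound on the exponents of an irreducible solution
  (\<open>irreducible_solution_bound\<close>). That its members are polynomial functions in the sense of a
  normed space rests on the continuity of linear functionals in finite dimension
  (\<open>linear_coordinates_bounded\<close>).\<close>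

section \<open>The orthogonal group of the plane\<close>

lemma rot_nth:
  "rot \<theta> $ 1 $ 1 = cos \<theta>" "rot \<theta> $ 1 $ 2 = - sin \<theta>"
  "rot \<theta> $ 2 $ 1 = sin \<theta>" "rot \<theta> $ 2 $ 2 = cos \<theta>"
  by (simp_all add: rot_def)

lemma reflection_nth:
  "reflection $ 1 $ 1 = 1" "reflection $ 1 $ 2 = 0"
  "reflection $ 2 $ 1 = 0" "reflection $ 2 $ 2 = - 1"
  by (simp_all add: reflection_def)

lemma det_rot: "det (rot \<theta>) = 1"
  by (simp add: det_2 rot_nth flip: power2_eq_square)

lemma det_reflection: "det reflection = - 1"
  by (simp add: det_2 reflection_nth)

lemma rot_in_O2: "rot \<theta> \<in> O2"
  by (simp add: O2_def orthogonal_matrix vec_eq_iff forall_2 matrix_matrix_mult_def sum_2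
      transpose_def mat_def rot_nth flip: power2_eq_square)

lemma reflection_in_O2: "reflection \<in> O2"
  by (simp add: O2_def orthogonal_matrix vec_eq_iff forall_2 matrix_matrix_mult_def sum_2
      transpose_def mat_def reflection_nth)

lemma transpose_in_O2: "g \<in> O2 \<Longrightarrow> transpose g \<in> O2"
  by (simp add: O2_def orthogonal_matrix_def)

lemma O2_cases:
  assumes "g \<in> O2"
  obtains \<theta> where "g = rot \<theta>" | \<theta> where "g = rot \<theta> ** reflection"
proof -
  define a b c d where "a = g $ 1 $ 1" and "b = g $ 1 $ 2" and "c = g $ 2 $ 1" and "d = g $ 2 $ 2"
  have "transpose g ** g = mat 1"
    using assms by (simp add: O2_def orthogonal_matrix_def)
  then have ac: "a\<^sup>2 + c\<^sup>2 = 1" and bd: "b\<^sup>2 + d\<^sup>2 = 1" and ab: "a * b + c * d = 0"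
    by (simp_all add: vec_eq_iff forall_2 matrix_matrix_mult_def sum_2
        transpose_def mat_def a_def b_def c_def d_def power2_eq_square)
  obtain \<theta> where \<theta>: "a = cos \<theta>" "c = sin \<theta>"
    using sincos_total_2pi[OF ac] by metis
  \<comment> \<open>The second column is orthogonal to the first, hence \<open>e\<close> times its quarter turn.\<close>
  define e where "e = a * d - b * c"
  have "b = - e * c" "d = e * a"
    using ac ab unfolding e_def by algebra+
  moreover have "e\<^sup>2 = 1"
    using ac bd ab unfolding e_def by algebra
  then have "e = 1 \<or> e = - 1"
    by (simp add: power2_eq_1_iff)
  ultimately have "g = rot \<theta> \<or> g = rot \<theta> ** reflection"
    using \<theta> by (auto simp: vec_eq_iff forall_2 matrix_matrix_mult_def sum_2 rot_nth reflection_nth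
        a_def b_def c_def d_def)
  then show thesis
    using that by blast
qed

section \<open>Linear coordinates on a normed space\<close>

text \<open>An isomorphism with the space of real families over \<open>I\<close>. The indices form a set because the
  dimension is a number and not a type.\<close>

definition linear_coordinates :: "'i set \<Rightarrow> ('i \<Rightarrow> 'v::real_normed_vector \<Rightarrow> real) \<Rightarrow> bool" where
  "linear_coordinates I c \<longleftrightarrow> finite I \<and> (\<forall>i\<in>I. linear (c i)) \<and>
     (\<forall>x. \<exists>v. \<forall>i\<in>I. c i v = x i) \<and> (\<forall>v. (\<forall>i\<in>I. c i v = 0) \<longrightarrow> v = 0)"

lemma linear_coordinates_dual_basis:
  assumes "linear_coordinates I c"
  obtains e where "\<And>i j. i \<in> I \<Longrightarrow> j \<in> I \<Longrightarrow> c i (e j) = (if i = j then 1 else 0)"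
    and "\<And>v. v = (\<Sum>j\<in>I. c j v *\<^sub>R e j)"
proof -
  have fin: "finite I"
    and linear: "\<And>i. i \<in> I \<Longrightarrow> linear (c i)"
    and surj: "\<And>x. \<exists>v. \<forall>i\<in>I. c i v = x i"
    and inj: "\<And>v. (\<And>i. i \<in> I \<Longrightarrow> c i v = 0) \<Longrightarrow> v = 0"
    using assms by (simp_all add: linear_coordinates_def)
  define e where "e j = (SOME u. \<forall>i\<in>I. c i u = (if i = j then 1 else 0))" for j
  have e: "c i (e j) = (if i = j then 1 else 0)" if "i \<in> I" for i j
    using someI_ex[OF surj[of "\<lambda>i. if i = j then 1 else 0"]] that unfolding e_def by blast
  have "v = (\<Sum>j\<in>I. c j v *\<^sub>R e j)" for v
  proof -
    have "c i (v - (\<Sum>j\<in>I. c j v *\<^sub>R e j)) = 0" if "i \<in> I" for i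
    proof -
      note lin = linear[OF that]
      have "c i (v - (\<Sum>j\<in>I. c j v *\<^sub>R e j)) = c i v - (\<Sum>j\<in>I. c j v * c i (e j))"
        by (simp add: linear_diff[OF lin] linear_sum[OF lin] linear_cmul[OF lin])
      also have "\<dots> = 0"
        using fin that by (simp add: e if_distrib cong: if_cong)
      finally show ?thesis .
    qed
    then have "v - (\<Sum>j\<in>I. c j v *\<^sub>R e j) = 0"
      by (rule inj)
    then show ?thesis
      by (simp only: right_minus_eq)
  qed
  with e show thesis
    by (rule that)
qed

text \<open>In finite dimension all linear functionals are continuous. The proof compares the given norm
  with the maximum norm of the coordinates: by compactness of the sphere of the latter, the former
  is bounded below there.\<close>

lemma linear_coordinates_bounded:
  fixes c :: "'i \<Rightarrow> 'v::real_normed_vector \<Rightarrow> real"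
  assumes coords: "linear_coordinates I c" and i0: "i0 \<in> I"
  shows "bounded_linear (c i0)"
proof -
  obtain e where e: "\<And>i j. i \<in> I \<Longrightarrow> j \<in> I \<Longrightarrow> c i (e j) = (if i = j then 1 else 0)"
    and expand: "\<And>v. v = (\<Sum>j\<in>I. c j v *\<^sub>R e j)"
    using linear_coordinates_dual_basis[OF coords] by blast
  have fin: "finite I" and linear: "\<And>i. i \<in> I \<Longrightarrow> linear (c i)"
    using coords by (simp_all add: linear_coordinates_def)
  define g where "g x = norm (\<Sum>j\<in>I. x j *\<^sub>R e j)" for x :: "'i \<Rightarrow> real"
  \<comment> \<open>The unit sphere of the maximum norm. The coordinates outside \<open>I\<close> are bounded as well, which
    makes it compact in the product topology.\<close>
  define K where "K = (\<Pi>\<^sub>E i\<in>UNIV. {-1..1::real}) \<inter> (\<Union>i\<in>I. {x. \<bar>x i\<bar> = 1})"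
  have coord_cont: "continuous_on UNIV (\<lambda>x::'i \<Rightarrow> real. x i)" for i
    by (rule continuous_on_product_coordinates)
  have "compact (\<Pi>\<^sub>E i\<in>(UNIV::'i set). {-1..1::real})"
    using compactin_PiE[of "\<lambda>_. euclidean" UNIV "\<lambda>_::'i. {-1..1::real}"]
    by (simp add: euclidean_product_topology)
  moreover have "closed (\<Union>i\<in>I. {x::'i \<Rightarrow> real. \<bar>x i\<bar> = 1})"
    using fin by (intro closed_UN) (auto intro!: closed_Collect_eq continuous_intros)
  ultimately have "compact K"
    unfolding K_def by (rule compact_Int_closed)
  moreover have "(\<lambda>_. 1) \<in> K"
    using i0 by (auto simp: K_def)
  moreover have "continuous_on K g"
    unfolding g_def
    by (intro continuous_intros continuous_on_subset[OF coord_cont]) auto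
  ultimately obtain y where y: "y \<in> K" and min: "\<And>x. x \<in> K \<Longrightarrow> g y \<le> g x"
    using continuous_attains_inf[of K g] by blast
  have "g y > 0"
  proof -
    obtain i where i: "i \<in> I" "\<bar>y i\<bar> = 1"
      using y by (auto simp: K_def)
    have lin: "linear (c i)"
      using linear i by simp
    have "c i (\<Sum>j\<in>I. y j *\<^sub>R e j) = (\<Sum>j\<in>I. y j * c i (e j))"
      by (simp add: linear_sum[OF lin] linear_cmul[OF lin])
    also have "\<dots> = y i"
      using fin i by (simp add: e if_distrib cong: if_cong)
    finally have "c i (\<Sum>j\<in>I. y j *\<^sub>R e j) \<noteq> 0"
      using i by auto
    then show ?thesis
      unfolding g_def using linear_0[OF lin] by force
  qed
  have bound: "\<bar>c i0 v\<bar> \<le> norm v * (1 / g y)" for v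
  proof -
    define \<mu> where "\<mu> = Max ((\<lambda>i. \<bar>c i v\<bar>) ` I)"
    have le: "\<bar>c i v\<bar> \<le> \<mu>" if "i \<in> I" for i
      using fin that by (simp add: \<mu>_def)
    have "\<mu> \<in> (\<lambda>i. \<bar>c i v\<bar>) ` I"
      unfolding \<mu>_def using fin i0 by (intro Max_in) auto
    then obtain k where k: "k \<in> I" "\<mu> = \<bar>c k v\<bar>"
      by blast
    show ?thesis
    proof (cases "\<mu> = 0")
      case True
      then show ?thesis
        using le[OF i0] \<open>g y > 0\<close> by simp
    next
      case False
      then have "\<mu> > 0"
        using k by simp
      define x where "x i = (if i \<in> I then c i v / \<mu> else 0)" for i
      have "x \<in> K"
      proof -
        have "\<bar>x i\<bar> \<le> 1" for i
          using le \<open>\<mu> > 0\<close> by (simp add: x_def)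
        then have "x i \<in> {-1..1}" for i
          by (metis abs_le_iff atLeastAtMost_iff minus_le_iff)
        moreover have "\<bar>x k\<bar> = 1"
          using k \<open>\<mu> > 0\<close> by (simp add: x_def)
        ultimately show ?thesis
          using k by (auto simp: K_def)
      qed
      have "(\<Sum>j\<in>I. x j *\<^sub>R e j) = (1 / \<mu>) *\<^sub>R (\<Sum>j\<in>I. c j v *\<^sub>R e j)"
        by (simp add: x_def scaleR_sum_right)
      then have "g x = norm v / \<mu>"
        using \<open>\<mu> > 0\<close> expand[of v] by (simp add: g_def)
      then have "g y \<le> norm v / \<mu>"
        using min[OF \<open>x \<in> K\<close>] by simp
      then have "\<mu> \<le> norm v * (1 / g y)"
        using \<open>\<mu> > 0\<close> \<open>g y > 0\<close> by (simp add: field_simps)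
      then show ?thesis
        using le[OF i0] by linarith
    qed
  qed
  have "linear (c i0)"
    using linear i0 .
  then show ?thesis
    using bound by (intro bounded_linear_intro[where K = "1 / g y"])
      (auto simp: linear_add linear_cmul)
qed

section \<open>Solutions of the Diophantine equation\<close>

definition exps_degree :: "nat \<Rightarrow> exponents \<Rightarrow> nat" where
  "exps_degree r m = (\<Sum>s<r. fst m s + snd m s)"

definition exps_weight :: "nat \<Rightarrow> (nat \<Rightarrow> nat) \<Rightarrow> exponents \<Rightarrow> int" where
  "exps_weight r n m = (\<Sum>s<r. int (n s) * int (fst m s)) - (\<Sum>s<r. int (n s) * int (snd m s))"

definition exponent_vectors :: "nat \<Rightarrow> exponents set" where
  "exponent_vectors r = {m. \<forall>s\<ge>r. fst m s = 0 \<and> snd m s = 0}"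

text \<open>The exponents of \<open>z\<^sub>s cnj z\<^sub>s = |z\<^sub>s|\<^sup>2\<close>.\<close>

definition norm_exps :: "nat \<Rightarrow> exponents" where
  "norm_exps s = (\<lambda>t. if t = s then 1 else 0, \<lambda>t. if t = s then 1 else 0)"

lemma solutions_iff: "m \<in> solutions r n \<longleftrightarrow> m \<in> exponent_vectors r \<and> exps_weight r n m = 0"
  by (cases m) (simp add: solutions_def exponent_vectors_def exps_weight_def)

lemma exps_degree_add: "exps_degree r (exps_add a b) = exps_degree r a + exps_degree r b"
  by (simp add: exps_degree_def exps_add_def sum.distrib)

lemma exps_weight_add: "exps_weight r n (exps_add a b) = exps_weight r n a + exps_weight r n b"
  by (simp add: exps_weight_def exps_add_def sum.distrib algebra_simps)

lemma exps_degree_conj: "exps_degree r (exps_conj m) = exps_degree r m"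
  by (simp add: exps_degree_def exps_conj_def add.commute)

lemma exps_weight_conj: "exps_weight r n (exps_conj m) = - exps_weight r n m"
  by (simp add: exps_weight_def exps_conj_def)

lemma exponent_vectors_add:
  "exps_add a b \<in> exponent_vectors r \<longleftrightarrow> a \<in> exponent_vectors r \<and> b \<in> exponent_vectors r"
  by (auto simp: exponent_vectors_def exps_add_def)

lemma exponent_vectors_conj: "exps_conj m \<in> exponent_vectors r \<longleftrightarrow> m \<in> exponent_vectors r"
  by (auto simp: exponent_vectors_def exps_conj_def)

lemma solutions_add: "a \<in> solutions r n \<Longrightarrow> b \<in> solutions r n \<Longrightarrow> exps_add a b \<in> solutions r n"
  by (simp add: solutions_iff exps_weight_add exponent_vectors_add)

lemma solutions_cancel:
  "exps_add a b \<in> solutions r n \<Longrightarrow> a \<in> solutions r n \<Longrightarrow> b \<in> solutions r n"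
  by (simp add: solutions_iff exps_weight_add exponent_vectors_add)

lemma solutions_conj: "m \<in> solutions r n \<Longrightarrow> exps_conj m \<in> solutions r n"
  by (simp add: solutions_iff exps_weight_conj exponent_vectors_conj)

lemma exps_add_zero: "exps_add m exps_zero = m"
  by (simp add: exps_add_def exps_zero_def)

lemma norm_exps_solution: "s < r \<Longrightarrow> norm_exps s \<in> solutions r n"
  by (auto simp: solutions_iff exponent_vectors_def exps_weight_def norm_exps_def)

lemma exps_degree_norm_exps: "s < r \<Longrightarrow> exps_degree r (norm_exps s) = 2"
  by (simp add: exps_degree_def norm_exps_def sum.distrib)

lemma exps_degree_pos:
  assumes "m \<in> exponent_vectors r" "m \<noteq> exps_zero"
  shows "exps_degree r m > 0"
proof (rule ccontr)
  assume "\<not> exps_degree r m > 0"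
  then have "fst m s = 0 \<and> snd m s = 0" for s
    using assms(1) by (cases "s < r") (auto simp: exps_degree_def exponent_vectors_def)
  then show False
    using assms(2) by (auto simp: exps_zero_def prod_eq_iff)
qed

lemma exps_le_decompose:
  assumes "\<And>s. fst a s \<le> fst m s" "\<And>s. snd a s \<le> snd m s"
  obtains b where "m = exps_add a b"
proof
  show "m = exps_add a (\<lambda>s. fst m s - fst a s, \<lambda>s. snd m s - snd a s)"
    using assms by (simp add: exps_add_def prod_eq_iff)
qed

lemma has_factor_decompose:
  assumes "m \<in> solutions r n" "has_factor_z_cnj r m"
  obtains s m' where "s < r" "m' \<in> solutions r n" "m = exps_add (norm_exps s) m'"
proof -
  obtain s where s: "s < r" "fst m s \<ge> 1" "snd m s \<ge> 1"
    using assms(2) by (auto simp: has_factor_z_cnj_def)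
  then obtain b where "m = exps_add (norm_exps s) b"
    by (elim exps_le_decompose[of "norm_exps s" m, rotated 2]) (auto simp: norm_exps_def)
  with s assms(1) show thesis
    using that norm_exps_solution solutions_cancel by metis
qed

text \<open>Solutions that differ by an exponent vector differ by a solution, so an irreducible solution has
  no proper nonzero solution below it.\<close>

lemma irreducible_minimal:
  assumes "exps_add a b \<in> irreducible_solutions r n" "a \<in> solutions r n" "a \<noteq> exps_zero"
  shows "b = exps_zero"
  using assms solutions_cancel[of a b r n] by (auto simp: irreducible_solutions_def)

lemma irreducible_solutions_conj:
  assumes "m \<in> irreducible_solutions r n"
  shows "exps_conj m \<in> irreducible_solutions r n"
proof -
  have inv: "exps_conj (exps_conj a) = a" for a
    by (simp add: exps_conj_def)
  have add: "exps_conj (exps_add a b) = exps_add (exps_conj a) (exps_conj b)" for a b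
    by (simp add: exps_conj_def exps_add_def)
  have zero: "exps_conj a = exps_zero \<longleftrightarrow> a = exps_zero" for a
    by (auto simp: exps_conj_def exps_zero_def prod_eq_iff)
  have "a = exps_zero \<or> b = exps_zero"
    if "a \<in> solutions r n" "b \<in> solutions r n" "exps_conj m = exps_add a b" for a b
  proof -
    have "m = exps_add (exps_conj a) (exps_conj b)"
      using arg_cong[OF that(3), of exps_conj] by (simp only: inv add)
    then have "exps_conj a = exps_zero \<or> exps_conj b = exps_zero"
      using assms that(1,2)[THEN solutions_conj] unfolding irreducible_solutions_def by blast
    then show ?thesis
      by (simp only: zero)
  qed
  moreover have "exps_conj m \<in> solutions r n" "exps_conj m \<noteq> exps_zero"
    using assms by (auto simp: irreducible_solutions_def zero solutions_conj)
  ultimately show ?thesis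
    unfolding irreducible_solutions_def by blast
qed

text \<open>A solution with \<open>\<alpha>\<^sub>s \<ge> n\<^sub>t\<close> and \<open>\<beta>\<^sub>t \<ge> n\<^sub>s\<close> has as a factor the solution formed by \<open>z\<^sub>s\<close> to the
  power \<open>n\<^sub>t\<close> and \<open>cnj z\<^sub>t\<close> to the power \<open>n\<^sub>s\<close>. An irreducible solution with large \<open>\<alpha>\<^sub>s\<close> therefore has
  every \<open>\<beta>\<^sub>t\<close> smaller than \<open>n\<^sub>s\<close>, and then the equation bounds \<open>\<alpha>\<^sub>s\<close> after all. The bound on \<open>\<beta>\<close>
  follows by conjugation.\<close>

lemma irreducible_solution_bound:
  assumes m: "m \<in> irreducible_solutions r n" and n: "\<forall>s<r. n s \<ge> 1" and s: "s < r"
  shows "fst m s \<le> (\<Sum>t<r. n t) + (\<Sum>t<r. n t) * (\<Sum>t<r. n t)"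
proof (rule ccontr)
  define K where "K = (\<Sum>t<r. n t)"
  assume "\<not> ?thesis"
  then have big: "fst m s > K + K * K"
    by (simp add: K_def)
  have le: "n t \<le> K" if "t < r" for t
    unfolding K_def using that by (intro member_le_sum) auto
  have small: "snd m t < n s" if t: "t < r" for t
  proof (rule ccontr)
    assume "\<not> snd m t < n s"
    define a :: exponents where
      "a = (\<lambda>u. if u = s then n t else 0, \<lambda>u. if u = t then n s else 0)"
    have "a \<in> solutions r n"
      using s t
      by (auto simp: a_def solutions_iff exponent_vectors_def exps_weight_def if_distrib cong: if_cong)
    have "a \<noteq> exps_zero"
    proof
      assume "a = exps_zero"
      then have "fst a s = 0"
        by (simp add: exps_zero_def)
      then show False
        using n t by (auto simp: a_def)
    qed
    obtain b where b: "m = exps_add a b"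
      using \<open>\<not> snd m t < n s\<close> big le[OF t]
      by (elim exps_le_decompose[of a m, rotated 2]) (auto simp: a_def)
    then have "m = a"
      using irreducible_minimal m \<open>a \<in> solutions r n\<close> \<open>a \<noteq> exps_zero\<close> exps_add_zero by metis
    then have "fst m s = n t"
      by (simp add: a_def)
    then show False
      using big le[OF t] by simp
  qed
  have "fst m s \<le> n s * fst m s"
    using n s by simp
  also have "\<dots> \<le> (\<Sum>t<r. n t * fst m t)"
    using s by (intro member_le_sum) auto
  also have "\<dots> = (\<Sum>t<r. n t * snd m t)"
  proof -
    have "int (\<Sum>t<r. n t * fst m t) = int (\<Sum>t<r. n t * snd m t)"
      using m by (simp add: irreducible_solutions_def solutions_iff exps_weight_def)
    then show ?thesis
      by linarith
  qed
  also have "\<dots> \<le> (\<Sum>t<r. n t * K)"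
    using less_le_trans[OF small le[OF s]] by (intro sum_mono mult_left_mono) (auto intro: less_imp_le)
  also have "\<dots> = K * K"
    by (simp add: K_def sum_distrib_right)
  finally show False
    using big by simp
qed

lemma finite_irreducible_solutions:
  assumes n: "\<forall>s<r. n s \<ge> 1"
  shows "finite (irreducible_solutions r n)"
proof -
  define C where "C = (\<Sum>t<r. n t) + (\<Sum>t<r. n t) * (\<Sum>t<r. n t)"
  define F where "F = {f :: nat \<Rightarrow> nat. \<forall>s. (s \<in> {..<r} \<longrightarrow> f s \<in> {..C}) \<and> (s \<notin> {..<r} \<longrightarrow> f s = 0)}"
  have "finite F"
    unfolding F_def by (rule finite_set_of_finite_funs) auto
  moreover have "irreducible_solutions r n \<subseteq> F \<times> F"
  proof
    fix m assume m: "m \<in> irreducible_solutions r n"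
    have "m \<in> exponent_vectors r"
      using m by (simp add: irreducible_solutions_def solutions_iff)
    moreover have "fst m s \<le> C" "snd m s \<le> C" if "s < r" for s
      using irreducible_solution_bound[OF m n that]
        irreducible_solution_bound[OF irreducible_solutions_conj[OF m] n that]
      by (simp_all add: C_def exps_conj_def)
    ultimately show "m \<in> F \<times> F"
      by (cases m) (auto simp: F_def exponent_vectors_def)
  qed
  ultimately show ?thesis
    by (meson finite_SigmaI finite_subset)
qed

section \<open>Monomials\<close>

lemma monomial_fun_add:
  "monomial_fun r z (exps_add a b) v = monomial_fun r z a v * monomial_fun r z b v"
  by (simp add: monomial_fun_def exps_add_def power_add prod.distrib)

lemma monomial_fun_conj: "monomial_fun r z (exps_conj m) v = cnj (monomial_fun r z m v)"
  by (simp add: monomial_fun_def exps_conj_def)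

lemma monomial_fun_norm_exps:
  assumes "s < r"
  shows "monomial_fun r z (norm_exps s) v = complex_of_real ((cmod (z s v))\<^sup>2)"
proof -
  have "(\<Prod>t<r. f t ^ (if t = s then 1 else 0)) = f s" for f :: "nat \<Rightarrow> complex"
    using assms by (simp add: if_distrib[of "\<lambda>k. _ ^ k"] cong: if_cong)
  then show ?thesis
    by (simp add: monomial_fun_def norm_exps_def complex_norm_square del: of_real_power)
qed

lemma monomial_fun_zero: "monomial_fun r z exps_zero v = 1"
  by (simp add: monomial_fun_def exps_zero_def)

lemma prod_cis: "(\<Prod>s<r. cis (f s)) = cis (\<Sum>s<r. f s)" for r :: nat
  by (induction r) (simp_all add: cis_mult)

lemma monomial_fun_rotate:
  assumes z: "\<And>s. s < r \<Longrightarrow> z s w = cis (real (n s) * \<theta>) * z s v"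
  shows "monomial_fun r z m w = cis (of_int (exps_weight r n m) * \<theta>) * monomial_fun r z m v"
proof -
  have "(\<Prod>s<r. z s w ^ fst m s) =
      (\<Prod>s<r. cis (real (fst m s) * (real (n s) * \<theta>))) * (\<Prod>s<r. z s v ^ fst m s)"
    unfolding prod.distrib[symmetric]
    by (intro prod.cong refl) (simp add: z power_mult_distrib Complex.DeMoivre)
  moreover have "(\<Prod>s<r. cnj (z s w) ^ snd m s) =
      (\<Prod>s<r. cis (real (snd m s) * - (real (n s) * \<theta>))) * (\<Prod>s<r. cnj (z s v) ^ snd m s)"
    unfolding prod.distrib[symmetric]
    by (intro prod.cong refl) (simp add: z power_mult_distrib Complex.DeMoivre cis_cnj)
  ultimately have "monomial_fun r z m w =
      cis ((\<Sum>s<r. real (fst m s) * (real (n s) * \<theta>)) + (\<Sum>s<r. real (snd m s) * - (real (n s) * \<theta>)))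
      * monomial_fun r z m v"
    by (simp add: monomial_fun_def prod_cis mult_ac flip: cis_mult)
  also have "(\<Sum>s<r. real (fst m s) * (real (n s) * \<theta>)) + (\<Sum>s<r. real (snd m s) * - (real (n s) * \<theta>)) =
      of_int (exps_weight r n m) * \<theta>"
    by (simp add: exps_weight_def sum_negf right_diff_distrib sum_distrib_left mult_ac)
  finally show ?thesis .
qed

lemma monomial_fun_reflect:
  assumes "\<And>s. s < r \<Longrightarrow> z s w = cnj (z s v)"
  shows "monomial_fun r z m w = cnj (monomial_fun r z m v)"
  using assms by (simp add: monomial_fun_def)

lemma monomial_fun_scale:
  assumes "\<And>s. s < r \<Longrightarrow> z s w = t *\<^sub>R z s v"
  shows "monomial_fun r z m w = t ^ exps_degree r m *\<^sub>R monomial_fun r z m v"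
  using assms
  by (simp add: monomial_fun_def exps_degree_def scaleR_conv_of_real power_mult_distrib
      prod.distrib sum.distrib power_add power_sum)

text \<open>A geometric sum whose ratio is an \<open>N\<close>-th root of unity. The hypotheses on \<open>w\<close> keep the ratio
  different from 1.\<close>

lemma sum_cis_regular_polygon:
  fixes w :: int
  assumes w: "\<bar>w\<bar> < int N" "w \<noteq> 0"
  shows "(\<Sum>k<N. cis (of_int w * (2 * pi * real k / real N))) = 0"
proof -
  define q where "q = cis (2 * pi * of_int w / real N)"
  have N: "real N > 0"
    using w by simp
  have "q \<noteq> 1"
  proof
    assume "q = 1"
    then have "cos (2 * pi * of_int w / real N) = 1"
      by (simp add: q_def complex_eq_iff)
    then obtain j :: int where "2 * pi * of_int w / real N = of_int j * 2 * pi"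
      by (auto simp: cos_one_2pi_int)
    then have "2 * pi * of_int w = 2 * pi * (of_int j * real N)"
      using N by (simp add: field_simps)
    then have "real_of_int w = of_int j * real N"
      by simp
    then have "real_of_int w = real_of_int (j * int N)"
      by simp
    then have "w = j * int N"
      by linarith
    then show False
      using w by (metis abs_mult abs_of_nat dvd_triv_right dvd_imp_le_int linorder_not_less)
  qed
  moreover have "q ^ N = 1"
  proof -
    have "q ^ N = cis (2 * pi * of_int w)"
      using N by (simp add: q_def Complex.DeMoivre)
    then show ?thesis
      by simp
  qed
  moreover have "(\<Sum>k<N. cis (of_int w * (2 * pi * real k / real N))) = (\<Sum>k<N. q ^ k)"
    by (intro sum.cong refl) (simp add: q_def Complex.DeMoivre mult_ac)
  ultimately show ?thesis
    by (simp add: geometric_sum)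
qed

section \<open>Generated algebras and polynomial functions\<close>

text \<open>Rules for membership in an algebra of functions leave the function in a syntactic form of their
  own; this one adapts it pointwise.\<close>

lemma generated_algebra_eq:
  "p \<in> generated_algebra B \<Longrightarrow> (\<And>v. q v = p v) \<Longrightarrow> q \<in> generated_algebra B"
  by (metis ext)

lemma generated_algebra_cmult:
  "p \<in> generated_algebra B \<Longrightarrow> (\<lambda>v. c * p v) \<in> generated_algebra B"
  by (intro generated_algebra.mult generated_algebra.const)

lemma generated_algebra_diff:
  assumes "p \<in> generated_algebra B" "q \<in> generated_algebra B"
  shows "(\<lambda>v. p v - q v) \<in> generated_algebra B"
  using generated_algebra.add[OF assms(1) generated_algebra_cmult[OF assms(2), of "- 1"]] by simp

definition complex_polynomial :: "('v::real_normed_vector \<Rightarrow> complex) \<Rightarrow> bool" where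
  "complex_polynomial f \<longleftrightarrow>
     real_polynomial_function (\<lambda>v. Re (f v)) \<and> real_polynomial_function (\<lambda>v. Im (f v))"

lemma complex_polynomial_mult:
  "complex_polynomial f \<Longrightarrow> complex_polynomial g \<Longrightarrow> complex_polynomial (\<lambda>v. f v * g v)"
  by (auto simp: complex_polynomial_def intro!: real_polynomial_function_diff)

lemma complex_polynomial_const: "complex_polynomial (\<lambda>v. c)"
  by (auto simp: complex_polynomial_def)

lemma complex_polynomial_cnj:
  assumes "complex_polynomial f"
  shows "complex_polynomial (\<lambda>v. cnj (f v))"
proof -
  have "real_polynomial_function (\<lambda>v. - 1 * Im (f v))"
    using assms unfolding complex_polynomial_def
    by (intro real_polynomial_function.intros(4) real_polynomial_function.intros(2)) simp
  then show ?thesis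
    using assms by (simp add: complex_polynomial_def)
qed

lemma complex_polynomial_power:
  "complex_polynomial f \<Longrightarrow> complex_polynomial (\<lambda>v. f v ^ k)"
  by (induction k) (simp_all add: complex_polynomial_const complex_polynomial_mult)

lemma complex_polynomial_prod:
  fixes r :: nat
  shows "(\<And>s. s < r \<Longrightarrow> complex_polynomial (f s)) \<Longrightarrow> complex_polynomial (\<lambda>v. \<Prod>s<r. f s v)"
  by (induction r) (simp_all add: complex_polynomial_const complex_polynomial_mult)

lemma complex_polynomial_monomial_fun:
  assumes "\<And>s. s < r \<Longrightarrow> complex_polynomial (z s)"
  shows "complex_polynomial (monomial_fun r z m)"
proof -
  have "complex_polynomial
      (\<lambda>v. (\<Prod>s<r. z s v ^ fst m s) * (\<Prod>s<r. cnj (z s v) ^ snd m s))"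
    using assms by (intro complex_polynomial_mult complex_polynomial_prod complex_polynomial_power
        complex_polynomial_cnj)
  then show ?thesis
    by (simp add: monomial_fun_def[abs_def])
qed

lemma homogeneous_function_mult:
  assumes "homogeneous_function p" "homogeneous_function q"
  shows "homogeneous_function (\<lambda>v. p v * q v)"
proof -
  obtain d e where "\<And>t v. p (t *\<^sub>R v) = t ^ d * p v" "\<And>t v. q (t *\<^sub>R v) = t ^ e * q v"
    using assms unfolding homogeneous_function_def by blast
  then have "\<forall>t v. p (t *\<^sub>R v) * q (t *\<^sub>R v) = t ^ (d + e) * (p v * q v)"
    by (simp add: power_add mult_ac)
  then show ?thesis
    unfolding homogeneous_function_def by blast
qed

lemma linear_homogeneous_function: "linear f \<Longrightarrow> homogeneous_function f"
  unfolding homogeneous_function_def by (intro exI[of _ 1]) (simp add: linear_cmul)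

section \<open>Representations with given isotypic coordinates\<close>

locale O2_module =
  fixes \<rho> :: "real^2^2 \<Rightarrow> 'v::real_normed_vector \<Rightarrow> 'v"
    and mm m0 r :: nat
    and n :: "nat \<Rightarrow> nat"
    and xi lam :: "nat \<Rightarrow> 'v \<Rightarrow> real"
    and z :: "nat \<Rightarrow> 'v \<Rightarrow> complex"
  assumes representation: "O2_representation \<rho>"
    and n_pos: "\<forall>s<r. n s \<ge> 1"
    and decomposition: "O2_decomposition \<rho> mm m0 r n xi lam z"
begin

abbreviation mon :: "exponents \<Rightarrow> 'v \<Rightarrow> complex" where
  "mon \<equiv> monomial_fun r z"

text \<open>Chiral: different from its mirror image. By \<open>mon_reflection\<close> below, conjugation is the effect of the
  reflection on monomials.\<close>

definition chiral_irreducibles :: "exponents set" where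
  "chiral_irreducibles = {m \<in> irreducible_solutions r n. m \<noteq> exps_conj m}"

definition basis :: "('v \<Rightarrow> real) set" where
  "basis =
    {lam k |k. k < m0} \<union>
    {(\<lambda>v. (cmod (z s v))\<^sup>2) |s. s < r} \<union>
    {(\<lambda>v. Re (mon m v)) |m. m \<in> chiral_irreducibles} \<union>
    {(\<lambda>v. xi i v * xi j v) |i j. i < mm \<and> j < mm} \<union>
    {(\<lambda>v. xi i v * Im (mon m v)) |i m. i < mm \<and> m \<in> chiral_irreducibles} \<union>
    {(\<lambda>v. Im (mon p v) * Im (mon q v)) |p q.
       p \<in> chiral_irreducibles \<and> q \<in> chiral_irreducibles \<and>
       \<not> has_factor_z_cnj r (exps_add p q) \<and>
       \<not> has_factor_z_cnj r (exps_add p (exps_conj q))}"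

abbreviation basis_algebra :: "('v \<Rightarrow> real) set" where
  "basis_algebra \<equiv> generated_algebra basis"

lemma basis_cases [consumes 1]:
  assumes "p \<in> basis"
  obtains k where "k < m0" "p = lam k"
  | s where "s < r" "p = (\<lambda>v. (cmod (z s v))\<^sup>2)"
  | m where "m \<in> chiral_irreducibles" "p = (\<lambda>v. Re (mon m v))"
  | i j where "i < mm" "j < mm" "p = (\<lambda>v. xi i v * xi j v)"
  | i m where "i < mm" "m \<in> chiral_irreducibles" "p = (\<lambda>v. xi i v * Im (mon m v))"
  | a b where "a \<in> chiral_irreducibles" "b \<in> chiral_irreducibles" "p = (\<lambda>v. Im (mon a v) * Im (mon b v))"
  using assms unfolding basis_def by blast

lemma linear_coords:
  "i < mm \<Longrightarrow> linear (xi i)" "k < m0 \<Longrightarrow> linear (lam k)" "s < r \<Longrightarrow> linear (z s)"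
  using decomposition unfolding O2_decomposition_def by blast+

lemma finite_chiral_irreducibles: "finite chiral_irreducibles"
  using finite_irreducible_solutions[OF n_pos] by (simp add: chiral_irreducibles_def)

lemma chiral_irreducibles_solutions: "m \<in> chiral_irreducibles \<Longrightarrow> m \<in> solutions r n"
  by (simp add: chiral_irreducibles_def irreducible_solutions_def)

lemma finite_basis: "finite basis"
proof -
  have "finite {(\<lambda>v. Im (mon p v) * Im (mon q v)) |p q. p \<in> chiral_irreducibles \<and> q \<in> chiral_irreducibles}"
    using finite_chiral_irreducibles by (intro finite_image_set2) simp_all
  then have "finite {(\<lambda>v. Im (mon p v) * Im (mon q v)) |p q.
       p \<in> chiral_irreducibles \<and> q \<in> chiral_irreducibles \<and>
       \<not> has_factor_z_cnj r (exps_add p q) \<and>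
       \<not> has_factor_z_cnj r (exps_add p (exps_conj q))}"
    by (rule rev_finite_subset) blast
  then show ?thesis
    unfolding basis_def using finite_chiral_irreducibles
    by (intro finite_UnI finite_image_set finite_image_set2) simp_all
qed

subsection \<open>The group action on the coordinates\<close>

lemma rho_mult: "g \<in> O2 \<Longrightarrow> h \<in> O2 \<Longrightarrow> \<rho> (g ** h) v = \<rho> g (\<rho> h v)"
  using representation by (simp add: O2_representation_def)

lemma inv_rho:
  assumes g: "g \<in> O2"
  shows "inv (\<rho> g) = \<rho> (transpose g)"
proof (rule inv_unique_comp)
  have "transpose g ** g = mat 1" "g ** transpose g = mat 1"
    using g by (simp_all add: O2_def orthogonal_matrix_def)
  moreover have "\<rho> (mat 1) = id"
    using representation by (simp add: O2_representation_def)
  ultimately show "\<rho> g \<circ> \<rho> (transpose g) = id" "\<rho> (transpose g) \<circ> \<rho> g = id"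
    using rho_mult[OF g transpose_in_O2[OF g]] rho_mult[OF transpose_in_O2[OF g] g]
    by (auto simp: fun_eq_iff)
qed

text \<open>Invariance under the generators of \<open>O2\<close> only, which is what the decomposition gives access to.
  It amounts to invariance under \<open>O2\<close> by \<open>O2_cases\<close>.\<close>

definition invariant :: "('v \<Rightarrow> real) \<Rightarrow> bool" where
  "invariant p \<longleftrightarrow> (\<forall>\<theta> v. p (\<rho> (rot \<theta>) v) = p v) \<and> (\<forall>v. p (\<rho> reflection v) = p v)"

lemma Inv_O2_iff: "p \<in> Inv_O2 \<rho> \<longleftrightarrow> real_polynomial_function p \<and> invariant p"
proof -
  have "(\<forall>g\<in>O2. star_action \<rho> g p = p) \<longleftrightarrow> (\<forall>g\<in>O2. \<forall>v. p (\<rho> (transpose g) v) = p v)"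
    by (auto simp: star_action_def inv_rho fun_eq_iff)
  also have "\<dots> \<longleftrightarrow> (\<forall>g\<in>O2. \<forall>v. p (\<rho> g v) = p v)"
    by (metis transpose_in_O2 transpose_transpose)
  also have "\<dots> \<longleftrightarrow> invariant p"
  proof
    assume "\<forall>g\<in>O2. \<forall>v. p (\<rho> g v) = p v"
    then show "invariant p"
      by (simp add: invariant_def rot_in_O2 reflection_in_O2)
  next
    assume p: "invariant p"
    show "\<forall>g\<in>O2. \<forall>v. p (\<rho> g v) = p v"
    proof (intro ballI allI)
      fix g v assume "g \<in> O2"
      then show "p (\<rho> g v) = p v"
        using p by (cases rule: O2_cases)
          (auto simp: invariant_def rho_mult rot_in_O2 reflection_in_O2)
    qed
  qed
  finally show ?thesis
    by (simp add: Inv_O2_def)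
qed

lemma xi_rot: "i < mm \<Longrightarrow> xi i (\<rho> (rot \<theta>) v) = xi i v"
  and xi_reflection: "i < mm \<Longrightarrow> xi i (\<rho> reflection v) = - xi i v"
  using decomposition
  by (simp_all add: O2_decomposition_def rot_in_O2 reflection_in_O2 det_rot det_reflection)

lemma invariant_lam: "k < m0 \<Longrightarrow> invariant (lam k)"
  using decomposition
  by (simp add: O2_decomposition_def invariant_def rot_in_O2 reflection_in_O2)

lemma z_rot: "s < r \<Longrightarrow> z s (\<rho> (rot \<theta>) v) = cis (real (n s) * \<theta>) * z s v"
  and z_reflection: "s < r \<Longrightarrow> z s (\<rho> reflection v) = cnj (z s v)"
  using decomposition by (simp_all add: O2_decomposition_def)

lemma mon_rot: "mon m (\<rho> (rot \<theta>) v) = cis (of_int (exps_weight r n m) * \<theta>) * mon m v"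
  by (rule monomial_fun_rotate) (rule z_rot)

lemma mon_reflection: "mon m (\<rho> reflection v) = cnj (mon m v)"
  by (rule monomial_fun_reflect) (rule z_reflection)

lemma mon_solution_rot: "m \<in> solutions r n \<Longrightarrow> mon m (\<rho> (rot \<theta>) v) = mon m v"
  by (simp add: mon_rot solutions_iff)

lemma invariant_basis:
  assumes "p \<in> basis"
  shows "invariant p"
  using assms
proof (cases rule: basis_cases)
  case (1 k)
  then show ?thesis
    by (simp add: invariant_lam)
qed (auto simp: invariant_def xi_rot xi_reflection z_rot z_reflection norm_mult
    mon_solution_rot mon_reflection dest!: chiral_irreducibles_solutions)

lemma invariant_algebra: "p \<in> basis_algebra \<Longrightarrow> invariant p"
  by (induction rule: generated_algebra.induct) (simp_all add: invariant_basis, simp_all add: invariant_def)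

subsection \<open>The basis consists of homogeneous polynomials\<close>

definition coord :: "nat + nat + nat + nat \<Rightarrow> 'v \<Rightarrow> real" where
  "coord = case_sum xi (case_sum lam (case_sum (\<lambda>s v. Re (z s v)) (\<lambda>s v. Im (z s v))))"

definition coord_indices :: "(nat + nat + nat + nat) set" where
  "coord_indices = {..<mm} <+> {..<m0} <+> {..<r} <+> {..<r}"

lemma coord_simps [simp]:
  "coord (Inl i) = xi i" "coord (Inr (Inl k)) = lam k"
  "coord (Inr (Inr (Inl s))) = (\<lambda>v. Re (z s v))" "coord (Inr (Inr (Inr s))) = (\<lambda>v. Im (z s v))"
  by (simp_all add: coord_def)

lemma coord_indices_cases [consumes 1]:
  assumes "j \<in> coord_indices"
  obtains i where "i < mm" "j = Inl i" | k where "k < m0" "j = Inr (Inl k)"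
  | s where "s < r" "j = Inr (Inr (Inl s))" | s where "s < r" "j = Inr (Inr (Inr s))"
  using assms unfolding coord_indices_def by (auto elim!: PlusE)

lemma linear_coordinates_coord: "linear_coordinates coord_indices coord"
proof -
  define \<Phi> where "\<Phi> = (\<lambda>v. (restrict (\<lambda>i. xi i v) {..<mm}, restrict (\<lambda>k. lam k v) {..<m0},
      restrict (\<lambda>s. z s v) {..<r}))"
  have bij: "bij_betw \<Phi> UNIV
      (({..<mm} \<rightarrow>\<^sub>E UNIV) \<times> ({..<m0} \<rightarrow>\<^sub>E UNIV) \<times> ({..<r} \<rightarrow>\<^sub>E UNIV))"
    using decomposition by (simp add: O2_decomposition_def \<Phi>_def)
  have lin: "linear (coord j)" if "j \<in> coord_indices" for j
    using that
  proof (cases rule: coord_indices_cases)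
    case (3 s)
    then show ?thesis
      using linear_compose[OF linear_coords(3) bounded_linear.linear[OF bounded_linear_Re]]
      by (simp add: o_def)
  next
    case (4 s)
    then show ?thesis
      using linear_compose[OF linear_coords(3) bounded_linear.linear[OF bounded_linear_Im]]
      by (simp add: o_def)
  qed (simp_all add: linear_coords)
  have surj: "\<exists>v. \<forall>j\<in>coord_indices. coord j v = x j" for x
  proof -
    define y where "y = (restrict (\<lambda>i. x (Inl i)) {..<mm}, restrict (\<lambda>k. x (Inr (Inl k))) {..<m0},
        restrict (\<lambda>s. Complex (x (Inr (Inr (Inl s)))) (x (Inr (Inr (Inr s))))) {..<r})"
    have "y \<in> ({..<mm} \<rightarrow>\<^sub>E UNIV) \<times> ({..<m0} \<rightarrow>\<^sub>E UNIV) \<times> ({..<r} \<rightarrow>\<^sub>E UNIV)"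
      by (simp add: y_def)
    then obtain v where v: "\<Phi> v = y"
      unfolding bij_betw_imp_surj_on[OF bij, symmetric] by (elim imageE) (rule that, simp)
    have restrict_eq: "f i = g i" if "restrict f S = restrict g S" "i \<in> S"
      for f g :: "nat \<Rightarrow> 'b" and S i
      using fun_cong[OF that(1), of i] that(2) by simp
    have xi: "restrict (\<lambda>i. xi i v) {..<mm} = restrict (\<lambda>i. x (Inl i)) {..<mm}"
      and lam: "restrict (\<lambda>k. lam k v) {..<m0} = restrict (\<lambda>k. x (Inr (Inl k))) {..<m0}"
      and z: "restrict (\<lambda>s. z s v) {..<r} =
        restrict (\<lambda>s. Complex (x (Inr (Inr (Inl s)))) (x (Inr (Inr (Inr s))))) {..<r}"
      using v unfolding \<Phi>_def y_def prod.inject by blast+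
    have "coord j v = x j" if "j \<in> coord_indices" for j
      using that
      by (cases rule: coord_indices_cases)
        (simp_all add: restrict_eq[OF xi] restrict_eq[OF lam] restrict_eq[OF z])
    then show ?thesis
      by blast
  qed
  have inj: "v = 0" if v: "\<forall>j\<in>coord_indices. coord j v = 0" for v
  proof -
    have "xi i v = xi i 0" if "i < mm" for i
      using v[rule_format, of "Inl i"] that linear_0[OF linear_coords(1)[OF that]]
      by (simp add: coord_indices_def InlI)
    moreover have "lam k v = lam k 0" if "k < m0" for k
      using v[rule_format, of "Inr (Inl k)"] that linear_0[OF linear_coords(2)[OF that]]
      by (simp add: coord_indices_def InlI InrI)
    moreover have "z s v = z s 0" if "s < r" for s
      using v[rule_format, of "Inr (Inr (Inl s))"] v[rule_format, of "Inr (Inr (Inr s))"] that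
        linear_0[OF linear_coords(3)[OF that]]
      by (simp add: coord_indices_def InlI InrI complex_eq_iff)
    ultimately have "\<Phi> v = \<Phi> 0"
      unfolding \<Phi>_def by (auto intro!: restrict_ext)
    then show ?thesis
      using bij_betw_imp_inj_on[OF bij] by (simp add: inj_eq)
  qed
  have "finite coord_indices"
    by (simp add: coord_indices_def)
  then show ?thesis
    unfolding linear_coordinates_def using lin surj inj by blast
qed

lemma polynomial_coord: "j \<in> coord_indices \<Longrightarrow> real_polynomial_function (coord j)"
  by (intro real_polynomial_function.intros(1) linear_coordinates_bounded[OF linear_coordinates_coord])

lemma polynomial_xi: "i < mm \<Longrightarrow> real_polynomial_function (xi i)"
  using polynomial_coord[of "Inl i"] by (simp add: coord_indices_def InlI)

lemma polynomial_lam: "k < m0 \<Longrightarrow> real_polynomial_function (lam k)"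
  using polynomial_coord[of "Inr (Inl k)"] by (simp add: coord_indices_def InlI InrI)

lemma polynomial_z: "s < r \<Longrightarrow> complex_polynomial (z s)"
  using polynomial_coord[of "Inr (Inr (Inl s))"] polynomial_coord[of "Inr (Inr (Inr s))"]
  by (simp add: coord_indices_def InlI InrI complex_polynomial_def)

lemma polynomial_mon:
  "real_polynomial_function (\<lambda>v. Re (mon m v))" "real_polynomial_function (\<lambda>v. Im (mon m v))"
  using complex_polynomial_monomial_fun[where r = r and z = z and m = m, OF polynomial_z]
  by (simp_all add: complex_polynomial_def)

lemma polynomial_basis:
  assumes "p \<in> basis"
  shows "real_polynomial_function p"
  using assms
proof (cases rule: basis_cases)
  case (2 s)
  then show ?thesis
    using polynomial_mon(1)[of "norm_exps s"] by (simp add: monomial_fun_norm_exps)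
qed (auto simp: polynomial_lam polynomial_xi polynomial_mon)

lemma homogeneous_mon:
  "homogeneous_function (\<lambda>v. Re (mon m v))" "homogeneous_function (\<lambda>v. Im (mon m v))"
proof -
  have "mon m (t *\<^sub>R v) = t ^ exps_degree r m *\<^sub>R mon m v" for t v
    by (rule monomial_fun_scale) (simp add: linear_cmul[OF linear_coords(3)])
  then show "homogeneous_function (\<lambda>v. Re (mon m v))" "homogeneous_function (\<lambda>v. Im (mon m v))"
    unfolding homogeneous_function_def by (auto intro!: exI[of _ "exps_degree r m"])
qed

lemma homogeneous_basis:
  assumes "p \<in> basis"
  shows "homogeneous_function p"
  using assms
proof (cases rule: basis_cases)
  case (2 s)
  then show ?thesis
    using homogeneous_mon(1)[of "norm_exps s"] by (simp add: monomial_fun_norm_exps)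
qed (simp_all add: linear_homogeneous_function linear_coords homogeneous_mon
    homogeneous_function_mult)

lemma algebra_subset_Inv_O2: "basis_algebra \<subseteq> Inv_O2 \<rho>"
proof
  fix p assume p: "p \<in> basis_algebra"
  then have "real_polynomial_function p"
    by (induction rule: generated_algebra.induct) (auto simp: polynomial_basis)
  then show "p \<in> Inv_O2 \<rho>"
    using p by (simp add: Inv_O2_iff invariant_algebra)
qed

subsection \<open>Monomial invariants lie in the generated algebra\<close>

lemma norm_in_algebra: "s < r \<Longrightarrow> (\<lambda>v. (cmod (z s v))\<^sup>2) \<in> basis_algebra"
  unfolding basis_def by (rule generated_algebra.gen) blast

lemma xi_xi_in_algebra: "i < mm \<Longrightarrow> j < mm \<Longrightarrow> (\<lambda>v. xi i v * xi j v) \<in> basis_algebra"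
  unfolding basis_def by (rule generated_algebra.gen) blast

lemma lam_in_algebra: "k < m0 \<Longrightarrow> lam k \<in> basis_algebra"
  unfolding basis_def by (rule generated_algebra.gen) blast

lemma solution_trichotomy [consumes 1, case_names zero irreducible reducible]:
  assumes "m \<in> solutions r n"
  obtains "m = exps_zero" | "m \<in> irreducible_solutions r n"
  | a b where "a \<in> solutions r n" "b \<in> solutions r n" "m = exps_add a b"
      "exps_degree r a > 0" "exps_degree r b > 0"
proof -
  have pos: "exps_degree r a > 0" if "a \<in> solutions r n" "a \<noteq> exps_zero" for a
    using that by (simp add: exps_degree_pos solutions_iff)
  have "m = exps_zero \<or> m \<in> irreducible_solutions r n \<or> (\<exists>a \<in> solutions r n. \<exists>b \<in> solutions r n.
      a \<noteq> exps_zero \<and> b \<noteq> exps_zero \<and> m = exps_add a b)"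
    using assms unfolding irreducible_solutions_def by blast
  then show thesis
    using that pos by metis
qed

lemma Im_self_conj: "m = exps_conj m \<Longrightarrow> Im (mon m v) = 0"
  using monomial_fun_conj[of r z m v] by (metis cnj.simps(2) equal_neg_zero)

text \<open>An irreducible solution equal to its conjugate contains some \<open>z\<^sub>s cnj z\<^sub>s\<close>, hence is equal to it;
  this is where the \<open>|z\<^sub>s|\<^sup>2\<close> enter.\<close>

lemma Re_irreducible_in_algebra:
  assumes m: "m \<in> irreducible_solutions r n"
  shows "(\<lambda>v. Re (mon m v)) \<in> basis_algebra"
proof (cases "m = exps_conj m")
  case False
  then have "m \<in> chiral_irreducibles"
    using m by (simp add: chiral_irreducibles_def)
  then show ?thesis
    unfolding basis_def by (intro generated_algebra.gen) blast
next
  case True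
  then have eq: "fst m = snd m"
    by (metis exps_conj_def fst_conv)
  have sol: "m \<in> solutions r n" and "m \<noteq> exps_zero"
    using m by (simp_all add: irreducible_solutions_def)
  then have "(\<Sum>s<r. fst m s + snd m s) \<noteq> 0"
    using exps_degree_pos[of m r] unfolding exps_degree_def solutions_iff by blast
  then obtain s where "s < r" "fst m s + snd m s \<noteq> 0"
    by (meson lessThan_iff sum.neutral)
  then have "has_factor_z_cnj r m"
    using eq by (auto simp: has_factor_z_cnj_def)
  then obtain s b where s: "s < r" and b: "m = exps_add (norm_exps s) b"
    using has_factor_decompose sol by metis
  have "norm_exps s \<noteq> exps_zero"
    using exps_degree_norm_exps[OF s] by (auto simp: exps_degree_def exps_zero_def)
  then have "b = exps_zero"
    using irreducible_minimal m norm_exps_solution[OF s] unfolding b by blast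
  then have "m = norm_exps s"
    using b exps_add_zero by simp
  then show ?thesis
    using norm_in_algebra[OF s] by (simp add: monomial_fun_norm_exps s)
qed

text \<open>The two claims support each other: at degree \<open>d\<close>, products of imaginary parts need real parts of
  smaller degree (after cancelling \<open>|z\<^sub>s|\<^sup>2\<close>), and real parts need products of imaginary parts of total
  degree \<open>d\<close>. Hence the products are settled first at each degree.\<close>

lemma Re_and_Im_Im_in_algebra:
  "(\<forall>m\<in>solutions r n. exps_degree r m = d \<longrightarrow> (\<lambda>v. Re (mon m v)) \<in> basis_algebra) \<and>
   (\<forall>a\<in>solutions r n. \<forall>b\<in>solutions r n. exps_degree r a + exps_degree r b = d \<longrightarrow>
      (\<lambda>v. Im (mon a v) * Im (mon b v)) \<in> basis_algebra)"
proof (induction d rule: less_induct)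
  case (less d)
  have IH_Re: "(\<lambda>v. Re (mon m v)) \<in> basis_algebra" if "m \<in> solutions r n" "exps_degree r m < d" for m
    using less that by blast
  have IH_Im: "(\<lambda>v. Im (mon a v) * Im (mon b v)) \<in> basis_algebra"
    if "a \<in> solutions r n" "b \<in> solutions r n" "exps_degree r a + exps_degree r b < d" for a b
    using less that by blast
  have Re_factor: "(\<lambda>v. Re (mon m v)) \<in> basis_algebra"
    if m: "m \<in> solutions r n" "exps_degree r m = d" "has_factor_z_cnj r m" for m
  proof -
    obtain s m' where s: "s < r" and m': "m' \<in> solutions r n" "m = exps_add (norm_exps s) m'"
      using has_factor_decompose[OF m(1,3)] by metis
    have "exps_degree r m' < d"
      using m(2) m'(2) s by (simp add: exps_degree_add exps_degree_norm_exps)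
    then have "(\<lambda>v. (cmod (z s v))\<^sup>2 * Re (mon m' v)) \<in> basis_algebra"
      using s m' by (intro generated_algebra.mult norm_in_algebra IH_Re)
    then show ?thesis
      by (rule generated_algebra_eq)
        (simp add: m'(2) monomial_fun_add monomial_fun_norm_exps s del: of_real_power)
  qed
  have Im_reducible: "(\<lambda>v. Im (mon (exps_add a1 a2) v) * Im (mon b v)) \<in> basis_algebra"
    if a: "a1 \<in> solutions r n" "a2 \<in> solutions r n" "exps_degree r a1 > 0" "exps_degree r a2 > 0"
      and b: "b \<in> solutions r n" and d: "exps_degree r (exps_add a1 a2) + exps_degree r b = d"
    for a1 a2 b
  proof -
    have "(\<lambda>v. Re (mon a1 v) * (Im (mon a2 v) * Im (mon b v)) +
        Re (mon a2 v) * (Im (mon a1 v) * Im (mon b v))) \<in> basis_algebra"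
      using a b d
      by (intro generated_algebra.add generated_algebra.mult IH_Re IH_Im) (auto simp: exps_degree_add)
    then show ?thesis
      by (rule generated_algebra_eq) (simp add: monomial_fun_add algebra_simps)
  qed
  have Im_Im: "(\<lambda>v. Im (mon a v) * Im (mon b v)) \<in> basis_algebra"
    if a: "a \<in> solutions r n" and b: "b \<in> solutions r n"
      and d: "exps_degree r a + exps_degree r b = d" for a b
    using a
  proof (cases rule: solution_trichotomy)
    case zero
    then show ?thesis
      using generated_algebra.const[of 0] by (simp add: monomial_fun_zero)
  next
    case (reducible a1 a2)
    then show ?thesis
      using Im_reducible b d by blast
  next
    case irr_a: irreducible
    from b show ?thesis
    proof (cases rule: solution_trichotomy)
      case zero
      then show ?thesis
        using generated_algebra.const[of 0] by (simp add: monomial_fun_zero)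
    next
      case (reducible b1 b2)
      have "(\<lambda>v. Im (mon (exps_add b1 b2) v) * Im (mon a v)) \<in> basis_algebra"
        using reducible a d by (intro Im_reducible) (simp_all add: add.commute)
      then show ?thesis
        by (rule generated_algebra_eq) (simp add: reducible)
    next
      case irr_b: irreducible
      note Re = Re_irreducible_in_algebra[OF irr_a] Re_irreducible_in_algebra[OF irr_b]
      consider "a = exps_conj a \<or> b = exps_conj b"
        | "has_factor_z_cnj r (exps_add a b)"
        | "has_factor_z_cnj r (exps_add a (exps_conj b))"
        | "a \<in> chiral_irreducibles" "b \<in> chiral_irreducibles" "\<not> has_factor_z_cnj r (exps_add a b)"
          "\<not> has_factor_z_cnj r (exps_add a (exps_conj b))"
        using irr_a irr_b unfolding chiral_irreducibles_def by blast
      then show ?thesis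
      proof cases
        case 1
        then have "Im (mon a v) * Im (mon b v) = 0" for v
          using Im_self_conj[of a v] Im_self_conj[of b v] by (metis mult_eq_0_iff)
        then show ?thesis
          by (rule generated_algebra_eq[OF generated_algebra.const])
      next
        case 2
        then have "(\<lambda>v. Re (mon (exps_add a b) v)) \<in> basis_algebra"
          using a b d by (intro Re_factor solutions_add) (simp_all add: exps_degree_add)
        then have "(\<lambda>v. Re (mon a v) * Re (mon b v) - Re (mon (exps_add a b) v)) \<in> basis_algebra"
          using Re by (intro generated_algebra_diff generated_algebra.mult)
        then show ?thesis
          by (rule generated_algebra_eq) (simp add: monomial_fun_add)
      next
        case 3
        then have "(\<lambda>v. Re (mon (exps_add a (exps_conj b)) v)) \<in> basis_algebra"
          using a b d
          by (intro Re_factor solutions_add solutions_conj)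
            (simp_all add: exps_degree_add exps_degree_conj)
        then have "(\<lambda>v. Re (mon (exps_add a (exps_conj b)) v) - Re (mon a v) * Re (mon b v)) \<in> basis_algebra"
          using Re by (intro generated_algebra_diff generated_algebra.mult)
        then show ?thesis
          by (rule generated_algebra_eq) (simp add: monomial_fun_add monomial_fun_conj)
      next
        case 4
        then show ?thesis
          unfolding basis_def by (intro generated_algebra.gen) blast
      qed
    qed
  qed
  have "(\<lambda>v. Re (mon m v)) \<in> basis_algebra" if m: "m \<in> solutions r n" and d: "exps_degree r m = d" for m
    using m
  proof (cases rule: solution_trichotomy)
    case zero
    then show ?thesis
      using generated_algebra.const[of 1] by (simp add: monomial_fun_zero)
  next
    case irreducible
    then show ?thesis
      by (rule Re_irreducible_in_algebra)
  next
    case (reducible a b)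
    then have "(\<lambda>v. Re (mon a v) * Re (mon b v) - Im (mon a v) * Im (mon b v)) \<in> basis_algebra"
      using d
      by (intro generated_algebra_diff generated_algebra.mult IH_Re Im_Im)
        (auto simp: exps_degree_add)
    then show ?thesis
      by (rule generated_algebra_eq) (simp add: reducible monomial_fun_add)
  qed
  then show ?case
    using Im_Im by blast
qed

lemma Re_solution_in_algebra: "m \<in> solutions r n \<Longrightarrow> (\<lambda>v. Re (mon m v)) \<in> basis_algebra"
  using Re_and_Im_Im_in_algebra by blast

text \<open>The imaginary part of a product is linear in the imaginary parts of the factors, so a single
  factor \<open>\<xi>\<^sub>i\<close> is carried along to the irreducible solutions.\<close>

lemma xi_Im_in_algebra:
  assumes i: "i < mm"
  shows "m \<in> solutions r n \<Longrightarrow> (\<lambda>v. xi i v * Im (mon m v)) \<in> basis_algebra"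
proof (induction "exps_degree r m" arbitrary: m rule: less_induct)
  case (less m)
  from less.prems show ?case
  proof (cases rule: solution_trichotomy)
    case zero
    then show ?thesis
      using generated_algebra.const[of 0] by (simp add: monomial_fun_zero)
  next
    case irreducible
    show ?thesis
    proof (cases "m = exps_conj m")
      case True
      then show ?thesis
        using generated_algebra.const[of 0] Im_self_conj by simp
    next
      case False
      then have "m \<in> chiral_irreducibles"
        using irreducible by (simp add: chiral_irreducibles_def)
      then show ?thesis
        using i unfolding basis_def by (intro generated_algebra.gen) blast
    qed
  next
    case (reducible a b)
    have "(\<lambda>v. Re (mon a v) * (xi i v * Im (mon b v)) + Re (mon b v) * (xi i v * Im (mon a v))) \<in> basis_algebra"
      using reducible
      by (intro generated_algebra.add generated_algebra.mult Re_solution_in_algebra less.hyps)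
        (auto simp: exps_degree_add)
    then show ?thesis
      by (rule generated_algebra_eq) (simp add: reducible monomial_fun_add algebra_simps)
  qed
qed

subsection \<open>Every polynomial is a combination of monomials over the generated algebra\<close>

text \<open>Coefficients are taken in the generated algebra rather than in the reals. It already contains the
  \<open>\<lambda>\<^sub>k\<close> and the \<open>\<xi>\<^sub>i \<xi>\<^sub>j\<close>, so at most one factor \<open>\<xi>\<^sub>i\<close> has to be kept apart, and averaging is linear over
  it because its members are invariant. The complex constant \<open>c\<close> lets one term stand for both the real
  and the imaginary part of a monomial.\<close>

inductive_set combinations :: "('v \<Rightarrow> real) set" where
  even: "P \<in> basis_algebra \<Longrightarrow> m \<in> exponent_vectors r \<Longrightarrow> (\<lambda>v. P v * Re (c * mon m v)) \<in> combinations"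
| odd: "P \<in> basis_algebra \<Longrightarrow> i < mm \<Longrightarrow> m \<in> exponent_vectors r \<Longrightarrow>
    (\<lambda>v. P v * xi i v * Re (c * mon m v)) \<in> combinations"
| add: "f \<in> combinations \<Longrightarrow> g \<in> combinations \<Longrightarrow> (\<lambda>v. f v + g v) \<in> combinations"

lemma combinations_eq: "f \<in> combinations \<Longrightarrow> (\<And>v. g v = f v) \<Longrightarrow> g \<in> combinations"
  by (metis ext)

lemma exps_zero_vector: "exps_zero \<in> exponent_vectors r"
  by (simp add: exps_zero_def exponent_vectors_def)

lemma algebra_subset_combinations:
  assumes "P \<in> basis_algebra"
  shows "P \<in> combinations"
  using combinations.even[OF assms exps_zero_vector, of 1] by (simp add: monomial_fun_zero)

lemma combinations_mult_algebra:
  assumes Q: "Q \<in> basis_algebra" and f: "f \<in> combinations"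
  shows "(\<lambda>v. f v * Q v) \<in> combinations"
  using f
proof induction
  case (even P m c)
  then show ?case
    using combinations.even[OF generated_algebra.mult[OF Q even(1)] even(2), of c]
    by (simp add: mult_ac)
next
  case (odd P i m c)
  then show ?case
    using combinations.odd[OF generated_algebra.mult[OF Q odd(1)] odd(2,3), of c]
    by (simp add: mult_ac)
next
  case (add f g)
  then show ?case
    using combinations.add[OF add.IH] by (simp add: distrib_right)
qed

lemma combinations_mult_xi:
  assumes i: "i < mm" and f: "f \<in> combinations"
  shows "(\<lambda>v. f v * xi i v) \<in> combinations"
  using f
proof induction
  case (even P m c)
  then show ?case
    using combinations.odd[OF even(1) i even(2), of c] by (simp add: mult_ac)
next
  case (odd P j m c)
  then show ?case
    using combinations.even[OF generated_algebra.mult[OF odd(1) xi_xi_in_algebra[OF odd(2) i]] odd(3), of c]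
    by (simp add: mult_ac)
next
  case (add f g)
  then show ?case
    using combinations.add[OF add.IH] by (simp add: distrib_right)
qed

lemma Re_times_Re: "Re x * Re y = (Re (x * y) + Re (x * cnj y)) / 2"
  by simp

text \<open>By \<open>Re_times_Re\<close>, a product of two real parts is again a combination of real parts, of
  the product monomial and of the product with the conjugate.\<close>

lemma combinations_mult_Re:
  assumes m': "m' \<in> exponent_vectors r" and f: "f \<in> combinations"
  shows "(\<lambda>v. f v * Re (c' * mon m' v)) \<in> combinations"
  using f
proof induction
  case (even P m c)
  have half: "(\<lambda>v. (1 / 2) * P v) \<in> basis_algebra"
    by (rule generated_algebra_cmult) fact
  have "(\<lambda>v. (1 / 2) * P v * Re (c * c' * mon (exps_add m m') v) +
      (1 / 2) * P v * Re (c * cnj c' * mon (exps_add m (exps_conj m')) v)) \<in> combinations"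
    using half even m'
    by (intro combinations.add combinations.even) (simp_all add: exponent_vectors_add exponent_vectors_conj)
  then show ?case
    by (rule combinations_eq)
      (simp add: monomial_fun_add monomial_fun_conj mult.assoc Re_times_Re[of "c * _"] mult.left_commute
        distrib_left del: times_complex.simps)
next
  case (odd P i m c)
  have half: "(\<lambda>v. (1 / 2) * P v) \<in> basis_algebra"
    by (rule generated_algebra_cmult) fact
  have "(\<lambda>v. (1 / 2) * P v * xi i v * Re (c * c' * mon (exps_add m m') v) +
      (1 / 2) * P v * xi i v * Re (c * cnj c' * mon (exps_add m (exps_conj m')) v)) \<in> combinations"
    using half odd m'
    by (intro combinations.add combinations.odd) (simp_all add: exponent_vectors_add exponent_vectors_conj)
  then show ?case
    by (rule combinations_eq)
      (simp add: monomial_fun_add monomial_fun_conj mult.assoc Re_times_Re[of "c * _"] mult.left_commute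
        distrib_left del: times_complex.simps)
next
  case (add f g)
  then show ?case
    using combinations.add[OF add.IH] by (simp add: distrib_right)
qed

lemma combinations_mult:
  assumes f: "f \<in> combinations" and g: "g \<in> combinations"
  shows "(\<lambda>v. f v * g v) \<in> combinations"
  using g
proof induction
  case (even P m c)
  show ?case
    using combinations_mult_Re[OF even(2) combinations_mult_algebra[OF even(1) f], of c]
    by (simp add: mult_ac)
next
  case (odd P i m c)
  show ?case
    using combinations_mult_Re[OF odd(3) combinations_mult_xi[OF odd(2)
          combinations_mult_algebra[OF odd(1) f]], of c]
    by (simp add: mult_ac)
next
  case (add f g)
  then show ?case
    using combinations.add[OF add.IH] by (simp add: distrib_left)
qed

lemma coord_combinations:
  assumes "j \<in> coord_indices"
  shows "coord j \<in> combinations"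
proof -
  define e :: "nat \<Rightarrow> exponents" where "e s = (\<lambda>t. if t = s then 1 else 0, \<lambda>_. 0)" for s
  have e: "e s \<in> exponent_vectors r" "mon (e s) v = z s v" if "s < r" for s v
    using that by (simp_all add: e_def exponent_vectors_def monomial_fun_def
        if_distrib[of "\<lambda>k. _ ^ k"] cong: if_cong)
  note one = generated_algebra.const[of 1 basis]
  from assms show ?thesis
  proof (cases rule: coord_indices_cases)
    case (1 i)
    then show ?thesis
      using combinations_mult_xi[OF 1(1) algebra_subset_combinations[OF one]] by simp
  next
    case (2 k)
    then show ?thesis
      using algebra_subset_combinations[OF lam_in_algebra] by simp
  next
    case (3 s)
    then show ?thesis
      using combinations.even[OF one e(1)[OF 3(1)], of 1] by (simp add: e(2))
  next
    case (4 s)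
    then show ?thesis
      using combinations.even[OF one e(1)[OF 4(1)], of "- \<i>"] by (simp add: e(2))
  qed
qed

lemma combinations_sum:
  assumes "finite J" "\<And>j. j \<in> J \<Longrightarrow> f j \<in> combinations"
  shows "(\<lambda>v. \<Sum>j\<in>J. f j v) \<in> combinations"
  using assms
proof (induction J rule: finite_induct)
  case empty
  then show ?case
    using algebra_subset_combinations[OF generated_algebra.const[of 0]] by simp
next
  case (insert j J)
  then show ?case
    using combinations.add[of "f j" "\<lambda>v. \<Sum>j\<in>J. f j v"] by simp
qed

lemma polynomial_combinations:
  assumes "real_polynomial_function p"
  shows "p \<in> combinations"
  using assms
proof induction
  case (linear f)
  then have lin: "linear f"
    by (rule bounded_linear.linear)
  obtain e where "\<And>i j. i \<in> coord_indices \<Longrightarrow> j \<in> coord_indices \<Longrightarrow>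
      coord i (e j) = (if i = j then 1 else 0)"
    and e: "\<And>v. v = (\<Sum>j\<in>coord_indices. coord j v *\<^sub>R e j)"
    using linear_coordinates_dual_basis[OF linear_coordinates_coord] by blast
  have "f v = (\<Sum>j\<in>coord_indices. coord j v * f (e j))" for v
    by (subst e[of v]) (simp add: linear_sum[OF lin] linear_cmul[OF lin])
  moreover have "(\<lambda>v. \<Sum>j\<in>coord_indices. coord j v * f (e j)) \<in> combinations"
    by (intro combinations_sum combinations_mult coord_combinations algebra_subset_combinations
        generated_algebra.const) (simp add: coord_indices_def)
  ultimately show ?case
    using combinations_eq by blast
qed (auto intro: algebra_subset_combinations generated_algebra.const combinations.add
    combinations_mult)

subsection \<open>Averaging over dihedral groups\<close>

text \<open>The mean over the symmetry group of a regular \<open>N\<close>-gon: its rotations, and its rotations composed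
  with the reflection.\<close>

definition average :: "nat \<Rightarrow> ('v \<Rightarrow> real) \<Rightarrow> 'v \<Rightarrow> real" where
  "average N p v =
     (\<Sum>k<N. p (\<rho> (rot (2 * pi * real k / real N)) v) +
             p (\<rho> (rot (2 * pi * real k / real N)) (\<rho> reflection v))) / (2 * real N)"

lemma average_invariant: "invariant p \<Longrightarrow> N > 0 \<Longrightarrow> average N p v = p v"
  by (simp add: average_def invariant_def)

lemma average_add: "average N (\<lambda>v. f v + g v) v = average N f v + average N g v"
  by (simp add: average_def sum.distrib add_divide_distrib)

text \<open>The factor \<open>Q\<close> is an element of the generated algebra (\<open>\<epsilon> = 1\<close>), or one times a coordinate \<open>\<xi>\<^sub>i\<close>
  (\<open>\<epsilon> = - 1\<close>). Unless the weight is zero, the average contains the vanishing sum over the \<open>N\<close>-gon.\<close>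

lemma average_term:
  fixes Q :: "'v \<Rightarrow> real" and \<epsilon> :: real
  assumes Q: "\<And>\<theta> v. Q (\<rho> (rot \<theta>) v) = Q v" "\<And>v. Q (\<rho> reflection v) = \<epsilon> * Q v"
    and N: "\<bar>exps_weight r n m\<bar> < int N"
  shows "average N (\<lambda>v. Q v * Re (c * mon m v)) v =
    (if exps_weight r n m = 0 then Q v * Re (c * (mon m v + \<epsilon> * cnj (mon m v))) / 2 else 0)"
proof -
  define w where "w = exps_weight r n m"
  define S where "S = (\<Sum>k<N. cis (of_int w * (2 * pi * real k / real N)))"
  have combine: "q * Re (c * (u * x)) + \<epsilon> * q * Re (c * (u * y)) = q * Re (c * u * (x + \<epsilon> * y))"
    for q :: real and u x y :: complex
    by (simp add: algebra_simps)
  have "average N (\<lambda>v. Q v * Re (c * mon m v)) v =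
      (\<Sum>k<N. Q v * Re (c * cis (of_int w * (2 * pi * real k / real N)) * (mon m v + \<epsilon> * cnj (mon m v))))
        / (2 * real N)"
    unfolding average_def
    by (simp only: Q mon_rot mon_reflection w_def[symmetric] combine)
  also have "\<dots> = Q v * Re (c * S * (mon m v + \<epsilon> * cnj (mon m v))) / (2 * real N)"
    unfolding S_def sum_distrib_left sum_distrib_right Re_sum ..
  finally have avg: "average N (\<lambda>v. Q v * Re (c * mon m v)) v =
      Q v * Re (c * S * (mon m v + \<epsilon> * cnj (mon m v))) / (2 * real N)" .
  show ?thesis
  proof (cases "w = 0")
    case True
    then have "c * S * (mon m v + \<epsilon> * cnj (mon m v)) =
        of_real (real N) * (c * (mon m v + \<epsilon> * cnj (mon m v)))"
      by (simp add: S_def mult_ac)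
    then have "Re (c * S * (mon m v + \<epsilon> * cnj (mon m v))) =
        real N * Re (c * (mon m v + \<epsilon> * cnj (mon m v)))"
      by (simp only: scaleR_complex.simps flip: scaleR_conv_of_real)
    moreover have "real N > 0"
      using N by simp
    ultimately show ?thesis
      using True unfolding avg w_def[symmetric] by simp
  next
    case False
    then have "S = 0"
      unfolding S_def using N by (intro sum_cis_regular_polygon) (simp_all add: w_def)
    then show ?thesis
      using False unfolding avg w_def[symmetric] by simp
  qed
qed

text \<open>For a single term, \<open>N\<close> has to exceed the weight of its monomial; quantifying over all large \<open>N\<close>
  makes the claim stable under addition.\<close>

lemma eventually_average_in_algebra:
  assumes "f \<in> combinations"
  shows "\<forall>\<^sub>F N in sequentially. average N f \<in> basis_algebra"
  using assms
proof induction
  case (even P m c)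
  show ?case
    using eventually_gt_at_top[of "nat \<bar>exps_weight r n m\<bar>"]
  proof eventually_elim
    case (elim N)
    have P: "P (\<rho> (rot \<theta>) v) = P v" "P (\<rho> reflection v) = 1 * P v" for \<theta> v
      using invariant_algebra[OF even(1)] by (simp_all add: invariant_def)
    have N: "\<bar>exps_weight r n m\<bar> < int N"
      using elim by linarith
    note avg = average_term[of P 1, OF P N, of c]
    show ?case
    proof (cases "exps_weight r n m = 0")
      case True
      then have "(\<lambda>v. P v * (Re c * Re (mon m v))) \<in> basis_algebra"
        using even by (intro generated_algebra.mult[OF even(1)] generated_algebra_cmult
            Re_solution_in_algebra) (simp add: solutions_iff)
      then show ?thesis
        by (rule generated_algebra_eq) (subst avg, simp add: True)
    next
      case False
      then show ?thesis
        by (intro generated_algebra_eq[OF generated_algebra.const[of 0]]) (simp only: avg if_False)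
    qed
  qed
next
  case (odd P i m c)
  show ?case
    using eventually_gt_at_top[of "nat \<bar>exps_weight r n m\<bar>"]
  proof eventually_elim
    case (elim N)
    have P: "P (\<rho> (rot \<theta>) v) * xi i (\<rho> (rot \<theta>) v) = P v * xi i v"
      "P (\<rho> reflection v) * xi i (\<rho> reflection v) = - 1 * (P v * xi i v)" for \<theta> v
      using invariant_algebra[OF odd(1)] odd(2)
      by (simp_all add: invariant_def xi_rot xi_reflection)
    have N: "\<bar>exps_weight r n m\<bar> < int N"
      using elim by linarith
    note avg = average_term[of "\<lambda>v. P v * xi i v" "- 1", OF P N, of c]
    show ?case
    proof (cases "exps_weight r n m = 0")
      case True
      then have "(\<lambda>v. P v * (- Im c * (xi i v * Im (mon m v)))) \<in> basis_algebra"
        using odd by (intro generated_algebra.mult[OF odd(1)] generated_algebra_cmult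
            xi_Im_in_algebra) (simp_all add: solutions_iff)
      then show ?thesis
        by (rule generated_algebra_eq) (subst avg, simp add: True)
    next
      case False
      then show ?thesis
        by (intro generated_algebra_eq[OF generated_algebra.const[of 0]]) (simp only: avg if_False)
    qed
  qed
next
  case (add f g)
  from add.IH show ?case
  proof eventually_elim
    case (elim N)
    from generated_algebra.add[OF this] show ?case
      by (rule generated_algebra_eq) (rule average_add)
  qed
qed

lemma Inv_O2_subset_algebra: "Inv_O2 \<rho> \<subseteq> basis_algebra"
proof
  fix p assume "p \<in> Inv_O2 \<rho>"
  then have p: "real_polynomial_function p" "invariant p"
    by (simp_all add: Inv_O2_iff)
  have "\<forall>\<^sub>F N in sequentially. average N p \<in> basis_algebra \<and> N > 0"
    using eventually_average_in_algebra[OF polynomial_combinations[OF p(1)]] eventually_gt_at_top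
    by (rule eventually_conj)
  then obtain N where "average N p \<in> basis_algebra" "N > 0"
    using eventually_happens by fastforce
  then show "p \<in> basis_algebra"
    using average_invariant[OF p(2)] generated_algebra_eq by metis
qed

lemma integrity_basis: "integrity_basis \<rho> basis"
  unfolding integrity_basis_def
  using finite_basis algebra_subset_Inv_O2 Inv_O2_subset_algebra homogeneous_basis
    generated_algebra.gen[of _ basis]
  by blast

end

theorem theorem5p5:
  fixes \<rho> :: "real^2^2 \<Rightarrow> 'v::real_normed_vector \<Rightarrow> 'v"
    and mm m0 r :: nat
    and n :: "nat \<Rightarrow> nat"
    and xi lam :: "nat \<Rightarrow> 'v \<Rightarrow> real"
    and z :: "nat \<Rightarrow> 'v \<Rightarrow> complex"
    and M :: "exponents set"
  assumes "O2_representation \<rho>"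
    and "\<forall>s<r. n s \<ge> 1"
    and "O2_decomposition \<rho> mm m0 r n xi lam z"
    and M_def: "M = {m \<in> irreducible_solutions r n. m \<noteq> exps_conj m}"
  shows "integrity_basis \<rho>
    ({lam k |k. k < m0} \<union>
     {(\<lambda>v. (cmod (z s v))\<^sup>2) |s. s < r} \<union>
     {(\<lambda>v. Re (monomial_fun r z m v)) |m. m \<in> M} \<union>
     {(\<lambda>v. xi i v * xi j v) |i j. i < mm \<and> j < mm} \<union>
     {(\<lambda>v. xi i v * Im (monomial_fun r z m v)) |i m. i < mm \<and> m \<in> M} \<union>
     {(\<lambda>v. Im (monomial_fun r z p v) * Im (monomial_fun r z q v)) |p q.
        p \<in> M \<and> q \<in> M \<and>
        \<not> has_factor_z_cnj r (exps_add p q) \<and>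
        \<not> has_factor_z_cnj r (exps_add p (exps_conj q))})"
proof -
  interpret O2_module \<rho> mm m0 r n xi lam z
    using assms(1-3) by unfold_locales
  have "M = chiral_irreducibles"
    by (simp only: M_def chiral_irreducibles_def)
  then show ?thesis
    using integrity_basis by (simp only: basis_def)
qed

end
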